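(* Let $(X,\leq_X)$ be a partially ordered set and let $p$ be a partial metric on $X$ such that $(X,p)$ is complete. Let $f:X\to X$ be a non-decreasing map with respect to $\leq_X$. Suppose that: (i) for all $x,y\in X$ with $y\leq_X x$, $$p(fx,fy)\leq p(x,y)-\psi(p(x,y)),$$ where $\psi:[0,+\infty)\to[0,+\infty)$ is a continuous and non-decreasing function such that $\psi(t)>0$ for all $t>0$, $\psi(0)=0$ and $\lim_{t\to+\infty}\psi(t)=+\infty$; (ii) there exists $x_0\in X$ such that $x_0\leq_X fx_0$; and that at least one of the following two conditions holds: (iii) $f$ is continuous in $(X,p)$; or (iii') whenever a sequence $\{x_n\}$ in $X$ that is non-decreasing with respect to $\leq_X$ converges in $(X,p)$ to a point $x\in X$, then $x_n\leq_X x$ for all $n$. Suppose in addition that for arbitrary two points $x,y\in X$ there exists $z\in X$ which is comparable (with respect to $\leq_X$) with both $x$ and $y$. Then the fixed point of $f$ is unique, i.e. $f$ has exactly one fixed point in $X$.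
   Context: A partial metric on a nonempty set $X$ is a function $p:X\times X\to[0,+\infty)$ such that for all $x,y,z\in X$: (p1) $x=y$ if and only if $p(x,x)=p(x,y)=p(y,y)$; (p2) $p(x,x)\leq p(x,y)$; (p3) $p(x,y)=p(y,x)$; (p4) $p(x,y)\leq p(x,z)+p(z,y)-p(z,z)$. The pair $(X,p)$ is called a partial metric space. The function $p^s(x,y)=2p(x,y)-p(x,x)-p(y,y)$ is then a metric on $X$. A sequence $\{x_n\}$ converges to $x\in X$ in $(X,p)$ if $p(x,x)=\lim_{n\to+\infty}p(x,x_n)$. It converges properly to $x$ if $p(x,x)=\lim_{n\to+\infty}p(x_n,x_n)=\lim_{n\to+\infty}p(x,x_n)$, equivalently $\lim_{n\to+\infty}p^s(x,x_n)=0$. It is a Cauchy sequence in $(X,p)$ if $\lim_{n,m\to+\infty}p(x_n,x_m)$ exists and is finite. $(X,p)$ is complete if every Cauchy sequence $\{x_n\}$ in $X$ converges to a point $x\in X$ such that $p(x,x)=\lim_{n,m\to+\infty}p(x_n,x_m)$. A map $T:X\to X$ is continuous in $(X,p)$ if for every $x_0\in X$ and every sequence $\{x_n\}$ in $X$: (a) if $x_n$ converges to $x_0$ in $(X,p)$ then $Tx_n$ converges to $Tx_0$ in $(X,p)$; and (b) if $x_n$ converges properly to $x_0$ in $(X,p)$ then $Tx_n$ converges properly to $Tx_0$ in $(X,p)$. A map $f:X\to X$ is non-decreasing with respect to $\leq_X$ if $x\leq_X y$ implies $fx\leq_X fy$. Two points $x,y\in X$ are comparable if $x\leq_X y$ or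 $y\leq_X x$. We write $fx$ for $f(x)$. *)

theory Defs
  imports "HOL-Analysis.Analysis"
begin

text \<open>
  As in the library's locale \<open>Metric_space\<close>, the space is an explicit carrier set \<open>X\<close>; the values of
  \<open>p\<close> outside \<open>X\<close> are irrelevant.
\<close>

locale Partial_metric_space =
  fixes X :: "'a set" and p :: "'a \<Rightarrow> 'a \<Rightarrow> real"
  assumes nonempty: "X \<noteq> {}"
    and nonneg: "\<And>x y. x \<in> X \<Longrightarrow> y \<in> X \<Longrightarrow> 0 \<le> p x y"
    and eq_iff: "\<And>x y. x \<in> X \<Longrightarrow> y \<in> X \<Longrightarrow> x = y \<longleftrightarrow> p x x = p x y \<and> p x y = p y y"
    and self_le: "\<And>x y. x \<in> X \<Longrightarrow> y \<in> X \<Longrightarrow> p x x \<le> p x y"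
    and commute: "\<And>x y. x \<in> X \<Longrightarrow> y \<in> X \<Longrightarrow> p x y = p y x"
    and triangle: "\<And>x y z. x \<in> X \<Longrightarrow> y \<in> X \<Longrightarrow> z \<in> X \<Longrightarrow> p x y \<le> p x z + p z y - p z z"
begin

text \<open>
  Limits need not be unique for this notion: a sequence may converge to many points.
\<close>

definition converges :: "(nat \<Rightarrow> 'a) \<Rightarrow> 'a \<Rightarrow> bool" where
  "converges xs x \<longleftrightarrow> range xs \<subseteq> X \<and> x \<in> X \<and> (\<lambda>n. p x (xs n)) \<longlonglongrightarrow> p x x"

definition converges_properly :: "(nat \<Rightarrow> 'a) \<Rightarrow> 'a \<Rightarrow> bool" where
  "converges_properly xs x \<longleftrightarrow> range xs \<subseteq> X \<and> x \<in> X \<and>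
     (\<lambda>n. p (xs n) (xs n)) \<longlonglongrightarrow> p x x \<and> (\<lambda>n. p x (xs n)) \<longlonglongrightarrow> p x x"

text \<open>
  The double limit over \<open>n, m \<rightarrow> \<infinity>\<close> is the limit along the product filter. In the next definition
  its finiteness is expressed by \<open>l\<close> being a real number.
\<close>

definition is_double_limit :: "(nat \<Rightarrow> 'a) \<Rightarrow> real \<Rightarrow> bool" where
  "is_double_limit xs l \<longleftrightarrow>
     ((\<lambda>(n, m). p (xs n) (xs m)) \<longlongrightarrow> l) (sequentially \<times>\<^sub>F sequentially)"

definition Cauchy_seq :: "(nat \<Rightarrow> 'a) \<Rightarrow> bool" where
  "Cauchy_seq xs \<longleftrightarrow> range xs \<subseteq> X \<and> (\<exists>l. is_double_limit xs l)"

definition complete_space :: bool where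
  "complete_space \<longleftrightarrow>
     (\<forall>xs. Cauchy_seq xs \<longrightarrow> (\<exists>x\<in>X. converges xs x \<and> is_double_limit xs (p x x)))"

definition continuous_self_map :: "('a \<Rightarrow> 'a) \<Rightarrow> bool" where
  "continuous_self_map T \<longleftrightarrow> T ` X \<subseteq> X \<and>
     (\<forall>x0\<in>X. \<forall>xs. range xs \<subseteq> X \<longrightarrow>
        (converges xs x0 \<longrightarrow> converges (\<lambda>n. T (xs n)) (T x0)) \<and>
        (converges_properly xs x0 \<longrightarrow> converges_properly (\<lambda>n. T (xs n)) (T x0)))"

end

end

theory Submission
  imports Defs
begin

text \<open>
  Iterating the contraction along two comparable points \<open>x\<close>, \<open>y\<close> gives
  \<open>p (f\<^sup>n x) (f\<^sup>n y) \<longlonglongrightarrow> 0\<close>. For \<open>x = x\<^sub>0\<close>, \<open>y = f x\<^sub>0\<close> this makes consecutive distances in the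
  orbit of \<open>x\<^sub>0\<close> vanish, and an invariance argument turns this into the Cauchy property: once a
  step is shorter than \<open>min (e/2) (\<psi> (e/2))\<close>, the orbit never moves further than \<open>e\<close> away, because
  at distance above \<open>e/2\<close> the contraction gains at least \<open>\<psi> (e/2)\<close>. The limit \<open>x\<close> has \<open>p x x = 0\<close>,
  and either of the alternative hypotheses shows that \<open>f x\<close> is also at vanishing distance from
  the orbit, so \<open>f x = x\<close>. For uniqueness, the orbit of a point comparable with two fixed points
  approaches both.
\<close>

text \<open>The sequence decreases to some limit \<open>c \<ge> 0\<close>. By monotonicity every
  step drops by at least \<open>\<psi> c\<close>, yet the drops tend to 0, so
  \<open>\<psi> c \<le> 0\<close>, which forces \<open>c = 0\<close>.\<close>

lemma tendsto_zero_if_decrease: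
  fixes a :: "nat \<Rightarrow> real" and \<psi> :: "real \<Rightarrow> real"
  assumes nonneg: "\<And>n. 0 \<le> a n"
    and psi_mono: "mono_on {0..} \<psi>"
    and psi_pos: "\<And>t. 0 < t \<Longrightarrow> 0 < \<psi> t"
    and psi_nonneg: "\<And>t. 0 \<le> t \<Longrightarrow> 0 \<le> \<psi> t"
    and step: "\<And>n. a (Suc n) \<le> a n - \<psi> (a n)"
  shows "a \<longlonglongrightarrow> 0"
proof -
  have dec: "decseq a"
    using step psi_nonneg[OF nonneg] by (intro decseq_SucI) (smt (verit))
  then obtain c where c: "a \<longlonglongrightarrow> c" "\<And>n. c \<le> a n"
    using decseq_convergent[of a 0] nonneg by blast
  have c0: "0 \<le> c"
    using c(1) nonneg by (intro LIMSEQ_le_const) auto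
  have "(\<lambda>n. a n - a (Suc n)) \<longlonglongrightarrow> c - c"
    by (intro tendsto_diff c(1) LIMSEQ_Suc)
  moreover have "\<psi> c \<le> a n - a (Suc n)" for n
    using step[of n] mono_onD[OF psi_mono, of c "a n"] c0 c(2)[of n] by auto
  ultimately have "\<psi> c \<le> 0"
    by (intro LIMSEQ_le_const[of "\<lambda>n. a n - a (Suc n)"]) auto
  then have "c = 0"
    using psi_pos[of c] c0 by linarith
  then show ?thesis
    using c(1) by simp
qed

section \<open>Vanishing distances and double limits in a partial metric space\<close>

context Partial_metric_space
begin

lemma eq_if_zero:
  assumes "x \<in> X" "y \<in> X" "p x y = 0"
  shows "x = y"
proof -
  have "p x x = 0" "p y y = 0"
    using assms self_le[of x y] self_le[of y x] nonneg[of x x] nonneg[of y y] commute[of x y] by auto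
  then show ?thesis
    using eq_iff[of x y] assms by auto
qed

text \<open>Convergence alone does not determine a limit in a partial metric space. Vanishing
  distances do: the triangle inequality through \<open>xs n\<close> forces
  \<open>p x y = 0\<close>.\<close>

lemma eq_if_tendsto_zero:
  assumes "x \<in> X" "y \<in> X" "range xs \<subseteq> X"
    and lim: "(\<lambda>n. p x (xs n)) \<longlonglongrightarrow> 0" "(\<lambda>n. p y (xs n)) \<longlonglongrightarrow> 0"
  shows "x = y"
proof -
  have "p x y \<le> p x (xs n) + p y (xs n)" for n
  proof -
    have "xs n \<in> X"
      using assms(3) by auto
    then show ?thesis
      using triangle[of x y "xs n"] nonneg[of "xs n" "xs n"] commute[of "xs n" y] assms(1,2) by simp
  qed
  moreover have "(\<lambda>n. p x (xs n) + p y (xs n)) \<longlonglongrightarrow> 0"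
    using tendsto_add[OF lim] by simp
  ultimately have "p x y \<le> 0"
    by (intro LIMSEQ_le_const[of "\<lambda>n. p x (xs n) + p y (xs n)"]) auto
  then show ?thesis
    using eq_if_zero nonneg[of x y] assms(1,2) by force
qed

text \<open>Symmetry of \<open>p\<close> reduces the double limit to pairs with
  \<open>n \<le> m\<close>, the form that an induction on \<open>m\<close> can deliver.\<close>

lemma is_double_limit_zeroI:
  assumes "range xs \<subseteq> X"
    and small: "\<And>e. 0 < e \<Longrightarrow> \<exists>N. \<forall>n\<ge>N. \<forall>m\<ge>n. p (xs n) (xs m) \<le> e"
  shows "is_double_limit xs 0"
  unfolding is_double_limit_def
proof (rule tendstoI)
  fix e :: real
  assume "0 < e"
  \<comment> \<open>Halving \<open>e\<close> turns the non-strict bound into the strict one that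
    \<open>tendstoI\<close> demands.\<close>
  then obtain N where N: "\<And>n m. N \<le> n \<Longrightarrow> n \<le> m \<Longrightarrow> p (xs n) (xs m) \<le> e / 2"
    using small[of "e / 2"] by auto
  have X: "xs n \<in> X" for n
    using assms(1) by auto
  have "p (xs n) (xs m) \<le> e / 2" if "N \<le> n" "N \<le> m" for n m
    using that N[of n m] N[of m n] commute[OF X X, of n m] by (cases "n \<le> m") auto
  then have "dist (p (xs n) (xs m)) 0 < e" if "N \<le> n" "N \<le> m" for n m
    using that nonneg[OF X X, of n m] \<open>0 < e\<close> by (smt (verit) dist_real_def field_sum_of_halves)
  moreover have "\<forall>\<^sub>F n in sequentially. N \<le> n"
    by (rule eventually_ge_at_top)
  ultimately show "\<forall>\<^sub>F z in sequentially \<times>\<^sub>F sequentially. dist (case z of (n, m) \<Rightarrow> p (xs n) (xs m)) 0 < e"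
    unfolding eventually_prod_filter by (intro exI[of _ "\<lambda>n. N \<le> n"]) auto
qed

lemma is_double_limit_unique:
  assumes "is_double_limit xs a" "is_double_limit xs b"
  shows "a = b"
  using assms unfolding is_double_limit_def
  by (intro tendsto_unique[of "sequentially \<times>\<^sub>F sequentially"]) (auto simp: prod_filter_eq_bot)

end

section \<open>Orbits of a weak contraction on an ordered partial metric space\<close>

locale ordered_weak_contraction = Partial_metric_space X p
  for X :: "'a set" and p :: "'a \<Rightarrow> 'a \<Rightarrow> real" +
  fixes le :: "'a \<Rightarrow> 'a \<Rightarrow> bool" (infix "\<sqsubseteq>" 50)
    and f :: "'a \<Rightarrow> 'a"
    and \<psi> :: "real \<Rightarrow> real"
  assumes refl: "\<And>x. x \<in> X \<Longrightarrow> x \<sqsubseteq> x"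
    and trans: "\<And>x y z. x \<in> X \<Longrightarrow> y \<in> X \<Longrightarrow> z \<in> X \<Longrightarrow> x \<sqsubseteq> y \<Longrightarrow> y \<sqsubseteq> z \<Longrightarrow> x \<sqsubseteq> z"
    and f_self: "f ` X \<subseteq> X"
    and f_mono: "monotone_on X (\<sqsubseteq>) (\<sqsubseteq>) f"
    and contraction: "\<And>x y. x \<in> X \<Longrightarrow> y \<in> X \<Longrightarrow> y \<sqsubseteq> x \<Longrightarrow>
          p (f x) (f y) \<le> p x y - \<psi> (p x y)"
    and psi_nonneg: "\<And>t. 0 \<le> t \<Longrightarrow> 0 \<le> \<psi> t"
    and psi_mono: "mono_on {0..} \<psi>"
    and psi_pos: "\<And>t. 0 < t \<Longrightarrow> 0 < \<psi> t"
begin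

lemma orbit_in: "x \<in> X \<Longrightarrow> (f ^^ n) x \<in> X"
  using f_self by (induction n) auto

lemma orbit_mono: "x \<in> X \<Longrightarrow> y \<in> X \<Longrightarrow> x \<sqsubseteq> y \<Longrightarrow> (f ^^ n) x \<sqsubseteq> (f ^^ n) y"
  using monotone_onD[OF f_mono] orbit_in by (induction n) auto

text \<open>Since \<open>f\<close> is monotone, the iterates stay comparable, so the contraction
  applies at every step and yields the recursion of \<open>tendsto_zero_if_decrease\<close>.\<close>

lemma orbits_tendsto_zero:
  assumes "x \<in> X" "y \<in> X" "x \<sqsubseteq> y \<or> y \<sqsubseteq> x"
  shows "(\<lambda>n. p ((f ^^ n) x) ((f ^^ n) y)) \<longlonglongrightarrow> 0"
  using assms(3)
proof (rule disjE)
  \<comment> \<open>The contraction is oriented, with its second argument below the first; the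
    opposite case follows by swapping the points.\<close>
  have *: "(\<lambda>n. p ((f ^^ n) x) ((f ^^ n) y)) \<longlonglongrightarrow> 0" if "x \<in> X" "y \<in> X" "y \<sqsubseteq> x" for x y
    by (rule tendsto_zero_if_decrease[OF _ psi_mono psi_pos psi_nonneg])
      (use that in \<open>auto intro: nonneg orbit_in contraction orbit_mono\<close>)
  show ?thesis if "y \<sqsubseteq> x"
    using * that assms by blast
  show ?thesis if "x \<sqsubseteq> y"
    using *[of y x] that assms by (simp add: commute orbit_in)
qed

lemma orbit_increasing:
  assumes "x \<in> X" "x \<sqsubseteq> f x"
  shows "monotone (\<le>) (\<sqsubseteq>) (\<lambda>n. (f ^^ n) x)"
proof (rule monotoneI)
  fix n m :: nat
  assume "n \<le> m"
  then show "(f ^^ n) x \<sqsubseteq> (f ^^ m) x"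
  proof (induction m rule: dec_induct)
    case base
    show ?case
      using assms refl orbit_in by blast
  next
    case (step m)
    have "(f ^^ m) x \<sqsubseteq> (f ^^ Suc m) x"
      using orbit_mono[of x "f x" m] assms f_self by (auto simp: funpow_swap1)
    then show ?case
      using trans step.IH orbit_in[OF assms(1)] by blast
  qed
qed

lemma orbit_double_limit:
  assumes "x \<in> X" "x \<sqsubseteq> f x"
  shows "is_double_limit (\<lambda>n. (f ^^ n) x) 0"
proof (rule is_double_limit_zeroI)
  let ?x = "\<lambda>n. (f ^^ n) x"
  have X: "?x n \<in> X" for n
    using orbit_in assms(1) .
  show "range ?x \<subseteq> X"
    using X by auto
  fix e :: real
  assume e: "0 < e"
  \<comment> \<open>The two bounds serve the two cases of the induction step: up to distance
    \<open>e / 2\<close> there is room for a step of length \<open>e / 2\<close>; beyond it the gain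
    \<open>\<psi> (e / 2)\<close> absorbs the step.\<close>
  define d where "d = min (e / 2) (\<psi> (e / 2))"
  have "0 < d"
    using e psi_pos by (simp add: d_def)
  moreover have "(\<lambda>n. p (?x n) (?x (Suc n))) \<longlonglongrightarrow> 0"
    using orbits_tendsto_zero[of x "f x"] assms f_self by (auto simp: funpow_swap1)
  ultimately have "\<forall>\<^sub>F n in sequentially. p (?x n) (?x (Suc n)) < d"
    by (intro order_tendstoD(2))
  then obtain N where N: "\<And>n. N \<le> n \<Longrightarrow> p (?x n) (?x (Suc n)) < d"
    unfolding eventually_sequentially by blast
  have "p (?x n) (?x m) \<le> e" if "N \<le> n" "n \<le> m" for n m
    using that(2)
  proof (induction m rule: dec_induct)
    \<comment> \<open>Self-distances need not be 0, but each is at most the distance to the next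
      iterate.\<close>
    case base
    show ?case
      using N[OF that(1)] self_le[OF X X, of n "Suc n"] e unfolding d_def by linarith
  next
    case (step m)
    let ?r = "p (?x n) (?x m)"
    have "?x n \<sqsubseteq> ?x m"
      using orbit_increasing[OF assms] step.hyps(1) by (auto dest: monotoneD)
    then have "p (?x (Suc n)) (?x (Suc m)) \<le> ?r - \<psi> ?r"
      using contraction[OF X X, of n m] commute[OF X X, of m n] commute[OF X X, of "Suc n" "Suc m"] by simp
    \<comment> \<open>The detour through \<open>?x (Suc n)\<close> splits the distance into one
      short step and the contracted image of the previous distance.\<close>
    moreover have "p (?x n) (?x (Suc m)) \<le> p (?x n) (?x (Suc n)) + p (?x (Suc n)) (?x (Suc m))"
      using triangle[OF X X X, of n "Suc m" "Suc n"] nonneg[OF X X, of "Suc n" "Suc n"] by linarith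
    ultimately have le: "p (?x n) (?x (Suc m)) \<le> d + ?r - \<psi> ?r"
      using N[OF that(1)] by linarith
    show ?case
    proof (cases "?r \<le> e / 2")
      case True
      then show ?thesis
        using le psi_nonneg[OF nonneg[OF X X], of n m] unfolding d_def by linarith
    next
      case False
      then have "\<psi> (e / 2) \<le> \<psi> ?r"
        using e by (intro mono_onD[OF psi_mono]) auto
      then show ?thesis
        using le step.IH unfolding d_def by linarith
    qed
  qed
  then show "\<exists>N. \<forall>n\<ge>N. \<forall>m\<ge>n. p (?x n) (?x m) \<le> e"
    by blast
qed

text \<open>Completeness provides a limit whose self-distance is a double limit of the orbit;
  uniqueness of double limits identifies it with 0.\<close>

lemma orbit_limit:
  assumes complete_space "x \<in> X" "x \<sqsubseteq> f x"
  obtains u where "u \<in> X" "converges (\<lambda>n. (f ^^ n) x) u" "p u u = 0"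
proof -
  have lim: "is_double_limit (\<lambda>n. (f ^^ n) x) 0"
    using orbit_double_limit assms(2,3) .
  then have "Cauchy_seq (\<lambda>n. (f ^^ n) x)"
    using orbit_in[OF assms(2)] unfolding Cauchy_seq_def by auto
  then show ?thesis
    using assms(1) is_double_limit_unique[OF _ lim] that unfolding complete_space_def by blast
qed

lemma fixed_point_exists:
  assumes complete_space "x \<in> X" "x \<sqsubseteq> f x"
    and cont_or_regular: "continuous_self_map f \<or>
       (\<forall>xs x. range xs \<subseteq> X \<longrightarrow> x \<in> X \<longrightarrow> monotone (\<le>) (\<sqsubseteq>) xs \<longrightarrow>
          converges xs x \<longrightarrow> (\<forall>n. xs n \<sqsubseteq> x))"
  shows "\<exists>u\<in>X. f u = u"
proof -
  let ?x = "\<lambda>n. (f ^^ n) x"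
  obtain u where u: "u \<in> X" "converges ?x u" "p u u = 0"
    using orbit_limit[OF assms(1-3)] .
  have X: "?x n \<in> X" "f (?x n) \<in> X" "f u \<in> X" for n
    using orbit_in[OF assms(2)] f_self u(1) by auto
  have lim: "(\<lambda>n. p u (?x n)) \<longlonglongrightarrow> 0"
    using u(2,3) unfolding converges_def by simp
  have "(\<lambda>n. p (f u) (f (?x n))) \<longlonglongrightarrow> 0"
    using cont_or_regular
  proof (rule disjE)
    assume cont: "continuous_self_map f"
    \<comment> \<open>Squeezing the self-distances below \<open>p u (?x n)\<close> upgrades
      convergence to proper convergence, which continuity of \<open>f\<close> preserves.\<close>
    have self: "(\<lambda>n. p (?x n) (?x n)) \<longlonglongrightarrow> 0"
      using tendsto_const lim
      by (rule real_tendsto_sandwich[rotated 2])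
        (use nonneg[OF X(1) X(1)] self_le[OF X(1) u(1)] commute[OF X(1) u(1)] in auto)
    then have "converges_properly ?x u"
      using u X lim unfolding converges_properly_def by auto
    then have "converges_properly (\<lambda>n. f (?x n)) (f u)"
      using cont[unfolded continuous_self_map_def, THEN conjunct2, rule_format, of u ?x] u(1) X(1)
      by auto
    then have "(\<lambda>n. p (f (?x n)) (f (?x n))) \<longlonglongrightarrow> p (f u) (f u)"
      and fx: "(\<lambda>n. p (f u) (f (?x n))) \<longlonglongrightarrow> p (f u) (f u)"
      unfolding converges_properly_def by auto
    \<comment> \<open>The images are the orbit shifted by one, so their self-distances tend to 0 as
      well as to \<open>p (f u) (f u)\<close>.\<close>
    moreover have "(\<lambda>n. p (f (?x n)) (f (?x n))) \<longlonglongrightarrow> 0"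
      using LIMSEQ_Suc[OF self] by simp
    ultimately have "p (f u) (f u) = 0"
      using LIMSEQ_unique by blast
    then show ?thesis
      using fx by simp
  next
    assume regular: "\<forall>xs x. range xs \<subseteq> X \<longrightarrow> x \<in> X \<longrightarrow> monotone (\<le>) (\<sqsubseteq>) xs \<longrightarrow>
          converges xs x \<longrightarrow> (\<forall>n. xs n \<sqsubseteq> x)"
    have "?x n \<sqsubseteq> u" for n
      using regular[rule_format, of ?x u] orbit_increasing[OF assms(2,3)] u(1,2) X(1) by auto
    then have "p (f u) (f (?x n)) \<le> p u (?x n)" for n
      using contraction[OF u(1) X(1)[of n]] psi_nonneg[OF nonneg[OF u(1) X(1)[of n]]] by fastforce
    then show ?thesis
      using nonneg[OF X(3) X(2)] by (intro real_tendsto_sandwich[OF _ _ tendsto_const lim]) auto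
  qed
  \<comment> \<open>The shifted orbit is at vanishing distance from both \<open>u\<close> and
    \<open>f u\<close>.\<close>
  then have "f u = u"
    using LIMSEQ_Suc[OF lim] X u(1) by (intro eq_if_tendsto_zero[of _ _ "\<lambda>n. f (?x n)"]) auto
  then show ?thesis
    using u(1) by blast
qed

lemma fixed_point_unique:
  assumes "u \<in> X" "f u = u" "v \<in> X" "f v = v" "z \<in> X"
    and "z \<sqsubseteq> u \<or> u \<sqsubseteq> z" "z \<sqsubseteq> v \<or> v \<sqsubseteq> z"
  shows "u = v"
proof (rule eq_if_tendsto_zero)
  \<comment> \<open>Fixed points have constant orbits, so comparing orbits measures the distance
    from \<open>u\<close> and \<open>v\<close> themselves.\<close>
  have "(f ^^ n) w = w" if "f w = w" for w n
    using that by (induction n) auto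
  then show "(\<lambda>n. p u ((f ^^ n) z)) \<longlonglongrightarrow> 0" "(\<lambda>n. p v ((f ^^ n) z)) \<longlonglongrightarrow> 0"
    using orbits_tendsto_zero[of u z] orbits_tendsto_zero[of v z] assms by auto
  show "range (\<lambda>n. (f ^^ n) z) \<subseteq> X"
    using orbit_in assms(5) by auto
qed (use assms in auto)

end

theorem theorem2p3:
  fixes X :: "'a set"
    and le :: "'a \<Rightarrow> 'a \<Rightarrow> bool" (infix "\<sqsubseteq>" 50)
    and p :: "'a \<Rightarrow> 'a \<Rightarrow> real"
    and f :: "'a \<Rightarrow> 'a"
    and \<psi> :: "real \<Rightarrow> real"
  assumes order: "partial_order_on X {(x, y). x \<in> X \<and> y \<in> X \<and> x \<sqsubseteq> y}"
    and pmetric: "Partial_metric_space X p"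
    and complete: "Partial_metric_space.complete_space X p"
    and f_self: "f ` X \<subseteq> X"
    and f_mono: "monotone_on X (\<sqsubseteq>) (\<sqsubseteq>) f"
    and contraction: "\<And>x y. x \<in> X \<Longrightarrow> y \<in> X \<Longrightarrow> y \<sqsubseteq> x \<Longrightarrow>
          p (f x) (f y) \<le> p x y - \<psi> (p x y)"
    and psi_nonneg: "\<And>t. 0 \<le> t \<Longrightarrow> 0 \<le> \<psi> t"
    and psi_cont: "continuous_on {0..} \<psi>"
    and psi_mono: "mono_on {0..} \<psi>"
    and psi_pos: "\<And>t. 0 < t \<Longrightarrow> 0 < \<psi> t"
    and psi_zero: "\<psi> 0 = 0"
    and psi_lim: "filterlim \<psi> at_top at_top"
    and start: "\<exists>x0\<in>X. x0 \<sqsubseteq> f x0"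
    and cont_or_regular:
      "Partial_metric_space.continuous_self_map X p f \<or>
       (\<forall>xs x. range xs \<subseteq> X \<longrightarrow> x \<in> X \<longrightarrow> monotone (\<le>) (\<sqsubseteq>) xs \<longrightarrow>
          Partial_metric_space.converges X p xs x \<longrightarrow> (\<forall>n. xs n \<sqsubseteq> x))"
    and comparable: "\<forall>x\<in>X. \<forall>y\<in>X. \<exists>z\<in>X. (z \<sqsubseteq> x \<or> x \<sqsubseteq> z) \<and> (z \<sqsubseteq> y \<or> y \<sqsubseteq> z)"
  shows "\<exists>!x. x \<in> X \<and> f x = x"
proof -
  interpret Partial_metric_space X p
    by (rule pmetric)
  interpret ordered_weak_contraction X p le f \<psi>
  proof
    show "x \<sqsubseteq> x" if "x \<in> X" for x
      using order that unfolding partial_order_on_def preorder_on_def refl_on_def by auto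
    show "x \<sqsubseteq> z" if "x \<in> X" "y \<in> X" "z \<in> X" "x \<sqsubseteq> y" "y \<sqsubseteq> z" for x y z
      using order that unfolding partial_order_on_def preorder_on_def trans_def by blast
  qed (use f_self f_mono contraction psi_nonneg psi_mono psi_pos in auto)
  have "\<exists>u\<in>X. f u = u"
    using start fixed_point_exists[OF complete _ _ cont_or_regular] by auto
  moreover have "u = v" if "u \<in> X" "f u = u" "v \<in> X" "f v = v" for u v
  proof -
    obtain z where "z \<in> X" "z \<sqsubseteq> u \<or> u \<sqsubseteq> z" "z \<sqsubseteq> v \<or> v \<sqsubseteq> z"
      using comparable \<open>u \<in> X\<close> \<open>v \<in> X\<close> by auto
    then show ?thesis
      using fixed_point_unique that by simp
  qed
  ultimately show ?thesis
    by blast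
qed

end
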